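(* For each $\mathcal F\in\{CR,SO\}$, the action protocol $P^{\mathit{intent}}$ implements the knowledge-based program $\mathbf P$ (taken with $\mathit{next}(h)=|h|\bmod|\mathcal L_{in}|$ and $\sigma(h)=\emptyset$ for all adversary histories $h$) with respect to the limited-communication context $\gamma_{\mathit{intent}}(\mathcal F)$.
   Context: **Setting.** $\mathrm{Ag}\subseteq\mathbb N$ is a (possibly infinite) set of agents. Lanes $\mathcal L=\{0,\dots,\ell-1\}$ are partitioned into incoming lanes $\mathcal L_{in}=\{0,\dots,k-1\}$ ($1<k<\ell$) and outgoing lanes $\mathcal L_{out}$. A move is an element of $\mathcal L_{in}\times\mathcal L_{out}$. A symmetric relation $\mathcal O\subseteq(\mathcal L_{in}\times\mathcal L_{out})^2$ is fixed; two moves are compatible if the pair is in $\mathcal O$; a move is compatible with a set of moves if it is compatible with all its elements. **Adversaries.** A transmission environment is $T\subseteq(\mathcal L_{in}\times\mathbb N)^2$ with $((l,0),(l',0))\in T$ for all $l,l'\in\mathcal L_{in}$. An adversary is $\alpha=(\tau,T,F_t,F_r)$ with $\tau:\mathrm{Ag}\to\mathbb N\times\mathcal L_{in}\times\mathcal L_{out}$ (arrival time, arrival lane, intended departure lane), where distinct agents with the same arrival time have different arrival lanes; $T$ a transmission environment; $F_t,F_r:\mathbb N\times\mathrm{Ag}\to\{0,1\}$ (value $0$ at $(m,i)$: $i$'s transmitter, resp. receiver, fails in round $m+1$). Adversary models: $CR$ is the set of all adversaries with $F_r\equiv1$ and such that $F_t(m,i)=0$ implies $F_t(m',i)=0$ for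 all $m'>m$; $SO$ is the set of all adversaries with $F_r\equiv1$. **Context $\gamma_{\mathit{intent}}(\mathcal F)$.** An environment state is $s_e=(\alpha,t,(q_l)_{l\in\mathcal L_{in}},\mathit{done})$ with $\alpha\in\mathcal F$, time $t\in\mathbb N$, a queue $q_l$ of agents per incoming lane (front is position $0$), and a set $\mathit{done}\subseteq\mathrm{Ag}$. Agent $i$'s sensor reading is $\langle\mathit{front}_i,\mathit{lane}_i,\mathit{intent}_i,\mathit{time}_i\rangle$, where $\mathit{front}_i=1$ iff $i$ is at the front of a queue, $\mathit{lane}_i=l$ if $i$ is in $q_l$, $\top$ if $i\in\mathit{done}$, $\bot$ otherwise, $\mathit{intent}_i$ is the departure lane in $\tau(i)$, and $\mathit{time}_i=t$. Agent $i$'s local state consists of a memory $M_i\subseteq\mathcal L_{in}\times\mathcal L_{out}$ (the set of moves received in broadcasts in the last round; initially empty) and the sensor reading. Actions are $\mathtt{go},\mathtt{noop}$; an action protocol $P$ consists of maps $P_i$ from local states of $i$ to actions. **Runs.** Initially $t=0$ and all queues and $\mathit{done}$ are empty. In round $m+1$ (from time $m$ to $m+1$): each agent $i$ performs $P_i$ of its local state; each agent at the front of a queue performing $\mathtt{go}$ is dequeued and added to $\mathit{done}$; then each agent $i$ with $\tau(i)=(m+1,l,l')$ is appended to $q_l$; time becomes $m+1$, $\alpha$ is unchanged, giving $s'_e$. Each agent $j$ with $\mathit{front}_j=1$ in $s_e'$ broadcasts the message $(\mathit{lane}_j,\mathit{intent}_j)$ (values in $s'_e$); other agents broadcast nothing.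 Agent $i$'s new memory $M_i$ is empty if $i$ is in no queue in $s_e'$ or $F_r(m,i)=0$; otherwise it is the set of messages broadcast by agents $j$ with $F_t(m,j)=1$ and ((lane, position) of $j$, (lane, position) of $i$)$\,\in T$ in $s'_e$ ($j=i$ allowed). $\mathcal I_{\gamma,P}$ is the system of all runs $r$ of $P$ in context $\gamma$; $r_i(m)$ is $i$'s local state at point $(r,m)$. $K_i\phi$ holds at $(r,m)$ iff $\phi$ holds at all points $(r',m')$ of the system with $r'_i(m')=r_i(m)$. $\mathit{going}_i$ holds at $(r,m)$ iff $\mathit{front}_i=1$ at $(r,m)$ and $\mathit{front}_i=0$ at $(r,m+1)$. **Program $\mathbf P$.** An adversary history of a run at time $m$ has length $m$, so at time $m$ the value of $\mathit{next}$ is $m\bmod|\mathcal L_{in}|$. $[a,b)$ denotes the cyclic interval of lanes $a,a+1,\dots,b-1$ modulo $|\mathcal L_{in}|$ (empty if $a=b$). Since $\sigma$ is empty, $\mathbf P$ is: agent $i$ does "if $K_i(\mathit{front}_i\wedge V_i')$ then $\mathtt{go}$ else $\mathtt{noop}$", where $V_i'$ says that the move $(\mathit{lane}_i,\mathit{intent}_i)$ is compatible with all moves $(\mathit{lane}_j,\mathit{intent}_j)$ of agents $j\neq i$ with $\mathit{lane}_j\in[\mathit{next},\mathit{lane}_i)$ such that $\mathit{going}_j$ holds. $P$ implements "if $K_i\phi_i$ then $\mathtt{go}$ else $\mathtt{noop}$" w.r.t. $\gamma$ if for all points $(r,m)$ of $\mathcal I_{\gamma,P}$ and all $i$: $P_i(r_i(m))=\mathtt{go}$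 iff $K_i\phi_i$ holds at $(r,m)$ in $\mathcal I_{\gamma,P}$. **Protocol $P^{\mathit{intent}}$.** From agent $i$'s local state (with $\mathit{lane}_i\in\mathcal L_{in}$) compute a set $\mathit{Pos}_i$ of moves: start with $\mathit{Pos}_i=\emptyset$; for $l$ ranging in cyclic order over $[\mathit{next},\mathit{lane}_i)$: (a) if some move $(l,l')$ with $l'\in\mathcal L_{out}$ is in $M_i$, then add $(l,l')$ to $\mathit{Pos}_i$ if it is compatible with the current $\mathit{Pos}_i$, and otherwise leave $\mathit{Pos}_i$ unchanged; (b) otherwise, add to $\mathit{Pos}_i$ all moves $(l,l')$, $l'\in\mathcal L_{out}$, that are compatible with the current $\mathit{Pos}_i$. Output $\mathit{Pos}_i$. $P^{\mathit{intent}}_i$: if $\mathit{front}_i$ and $(\mathit{lane}_i,\mathit{intent}_i)$ is compatible with $\mathit{Pos}_i$, then $\mathtt{go}$, else $\mathtt{noop}$.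
   Formalization: The set of agents is assumed to be infinite or to have at least as many elements as there are incoming lanes; with fewer agents the claim fails, e.g. two incoming lanes, a single agent and an empty compatibility relation. *)

theory Defs
  imports Main
begin

text \<open>
  Agents and lanes are natural numbers. The parameters \<open>Ag\<close> (the set of agents), \<open>k\<close> (number of
  incoming lanes), \<open>n\<close> (number of all lanes) and \<open>Comp\<close> (the compatibility relation) are passed
  explicitly. Functions on agents are total; their values outside \<open>Ag\<close> are never used.
\<close>

type_synonym agent = nat
type_synonym move = "nat \<times> nat"
type_synonym location = "nat \<times> nat"  \<comment> \<open>(lane, position in the queue of the lane)\<close>

definition in_lanes :: "nat \<Rightarrow> nat set" where
  "in_lanes k = {..<k}"

definition out_lanes :: "nat \<Rightarrow> nat \<Rightarrow> nat set" where
  "out_lanes k n = {k..<n}"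

definition moves :: "nat \<Rightarrow> nat \<Rightarrow> move set" where
  "moves k n = in_lanes k \<times> out_lanes k n"

definition compatible :: "(move \<times> move) set \<Rightarrow> move \<Rightarrow> move set \<Rightarrow> bool" where
  "compatible Comp \<mu> S \<longleftrightarrow> (\<forall>\<nu>\<in>S. (\<mu>, \<nu>) \<in> Comp)"


subsection \<open>Adversaries\<close>

text \<open>
  In \<open>xmit_ok\<close> and \<open>recv_ok\<close>, \<open>False\<close> at \<open>(m, i)\<close> means that the transmitter (resp. receiver) of
  \<open>i\<close> fails in round \<open>m + 1\<close>.
\<close>

record adversary =
  arrival :: "agent \<Rightarrow> nat \<times> nat \<times> nat"  \<comment> \<open>arrival time, arrival lane, departure lane\<close>
  env_trans :: "(location \<times> location) set"
  xmit_ok :: "nat \<Rightarrow> agent \<Rightarrow> bool"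
  recv_ok :: "nat \<Rightarrow> agent \<Rightarrow> bool"

definition arr_time :: "adversary \<Rightarrow> agent \<Rightarrow> nat" where
  "arr_time \<alpha> i = fst (arrival \<alpha> i)"

definition arr_lane :: "adversary \<Rightarrow> agent \<Rightarrow> nat" where
  "arr_lane \<alpha> i = fst (snd (arrival \<alpha> i))"

definition dep_lane :: "adversary \<Rightarrow> agent \<Rightarrow> nat" where
  "dep_lane \<alpha> i = snd (snd (arrival \<alpha> i))"

definition transmission_env :: "nat \<Rightarrow> (location \<times> location) set \<Rightarrow> bool" where
  "transmission_env k T \<longleftrightarrow>
     T \<subseteq> (in_lanes k \<times> UNIV) \<times> (in_lanes k \<times> UNIV) \<and>
     (\<forall>l\<in>in_lanes k. \<forall>l'\<in>in_lanes k. ((l, 0), (l', 0)) \<in> T)"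

definition adversaries :: "nat set \<Rightarrow> nat \<Rightarrow> nat \<Rightarrow> adversary set" where
  "adversaries Ag k n = {\<alpha>.
     (\<forall>i\<in>Ag. arr_lane \<alpha> i \<in> in_lanes k \<and> dep_lane \<alpha> i \<in> out_lanes k n) \<and>
     (\<forall>i\<in>Ag. \<forall>j\<in>Ag. i \<noteq> j \<and> arr_time \<alpha> i = arr_time \<alpha> j \<longrightarrow> arr_lane \<alpha> i \<noteq> arr_lane \<alpha> j) \<and>
     transmission_env k (env_trans \<alpha>)}"

definition SO :: "nat set \<Rightarrow> nat \<Rightarrow> nat \<Rightarrow> adversary set" where
  "SO Ag k n = {\<alpha> \<in> adversaries Ag k n. \<forall>m. \<forall>i\<in>Ag. recv_ok \<alpha> m i}"

definition CR :: "nat set \<Rightarrow> nat \<Rightarrow> nat \<Rightarrow> adversary set" where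
  "CR Ag k n = {\<alpha> \<in> adversaries Ag k n.
     (\<forall>m. \<forall>i\<in>Ag. recv_ok \<alpha> m i) \<and>
     (\<forall>m. \<forall>i\<in>Ag. \<not> xmit_ok \<alpha> m i \<longrightarrow> (\<forall>m'>m. \<not> xmit_ok \<alpha> m' i))}"


subsection \<open>States\<close>

record env_state =
  adv :: adversary
  time :: nat
  queue :: "nat \<Rightarrow> agent list"
  departed :: "agent set"

datatype lane_reading = In nat | Top | Bot

record local_state =
  memory :: "move set"
  front :: bool
  lane :: lane_reading
  intent :: nat
  clock :: nat

text \<open>A global state: the remaining components of the local states are sensor readings of \<open>env\<close>.\<close>

record global_state =
  env :: env_state
  mem :: "agent \<Rightarrow> move set"

definition located :: "nat \<Rightarrow> env_state \<Rightarrow> agent \<Rightarrow> location \<Rightarrow> bool" where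
  "located k e i x \<longleftrightarrow> fst x \<in> in_lanes k \<and> snd x < length (queue e (fst x)) \<and>
     queue e (fst x) ! snd x = i"

definition queued :: "nat \<Rightarrow> env_state \<Rightarrow> agent \<Rightarrow> bool" where
  "queued k e i \<longleftrightarrow> (\<exists>x. located k e i x)"

text \<open>In reachable states an agent occurs at most once in the queues, so its location is unique.\<close>

definition location_of :: "nat \<Rightarrow> env_state \<Rightarrow> agent \<Rightarrow> location" where
  "location_of k e i = (THE x. located k e i x)"

definition at_front :: "nat \<Rightarrow> env_state \<Rightarrow> agent \<Rightarrow> bool" where
  "at_front k e i \<longleftrightarrow> (\<exists>l. located k e i (l, 0))"

definition lane_of :: "nat \<Rightarrow> env_state \<Rightarrow> agent \<Rightarrow> lane_reading" where
  "lane_of k e i =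
     (if queued k e i then In (fst (location_of k e i))
      else if i \<in> departed e then Top else Bot)"

definition local_of :: "nat \<Rightarrow> global_state \<Rightarrow> agent \<Rightarrow> local_state" where
  "local_of k s i =
     \<lparr> memory = mem s i,
       front = at_front k (env s) i,
       lane = lane_of k (env s) i,
       intent = dep_lane (adv (env s)) i,
       clock = time (env s) \<rparr>"


subsection \<open>Runs\<close>

datatype action = Go | Noop

type_synonym protocol = "agent \<Rightarrow> local_state \<Rightarrow> action"
type_synonym run = "nat \<Rightarrow> global_state"

definition initial :: "adversary \<Rightarrow> global_state" where
  "initial \<alpha> =
     \<lparr> env = \<lparr> adv = \<alpha>, time = 0, queue = (\<lambda>_. []), departed = {} \<rparr>, mem = (\<lambda>_. {}) \<rparr>"

text \<open>
  Distinct agents arriving at the same time arrive in different lanes, so the list has at most one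
  element.
\<close>

definition arriving :: "nat set \<Rightarrow> adversary \<Rightarrow> nat \<Rightarrow> nat \<Rightarrow> agent list" where
  "arriving Ag \<alpha> m l = sorted_list_of_set {i \<in> Ag. arr_time \<alpha> i = m \<and> arr_lane \<alpha> i = l}"

definition env_step :: "nat set \<Rightarrow> nat \<Rightarrow> (agent \<Rightarrow> action) \<Rightarrow> env_state \<Rightarrow> env_state" where
  "env_step Ag k act e =
     \<lparr> adv = adv e,
       time = time e + 1,
       queue = (\<lambda>l. (case queue e l of [] \<Rightarrow> [] | i # q \<Rightarrow> if act i = Go then q else i # q)
                    @ arriving Ag (adv e) (time e + 1) l),
       departed = departed e \<union> {i \<in> Ag. at_front k e i \<and> act i = Go} \<rparr>"

definition broadcast :: "nat \<Rightarrow> env_state \<Rightarrow> agent \<Rightarrow> move option" where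
  "broadcast k e j =
     (if at_front k e j then Some (fst (location_of k e j), dep_lane (adv e) j) else None)"

text \<open>The new memory of \<open>i\<close> in round \<open>m + 1\<close>, where \<open>e\<close> is the environment state at time \<open>m + 1\<close>.\<close>

definition received :: "nat set \<Rightarrow> nat \<Rightarrow> nat \<Rightarrow> env_state \<Rightarrow> agent \<Rightarrow> move set" where
  "received Ag k m e i =
     (if \<not> queued k e i \<or> \<not> recv_ok (adv e) m i then {}
      else {\<mu>. \<exists>j\<in>Ag. broadcast k e j = Some \<mu> \<and> xmit_ok (adv e) m j \<and>
                 (location_of k e j, location_of k e i) \<in> env_trans (adv e)})"

definition step :: "nat set \<Rightarrow> nat \<Rightarrow> protocol \<Rightarrow> global_state \<Rightarrow> global_state" where
  "step Ag k P s =
     (let e' = env_step Ag k (\<lambda>i. P i (local_of k s i)) (env s)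
      in \<lparr> env = e', mem = received Ag k (time (env s)) e' \<rparr>)"

text \<open>The system of all runs of \<open>P\<close> in the context given by the set \<open>F\<close> of adversaries.\<close>

definition runs :: "nat set \<Rightarrow> nat \<Rightarrow> adversary set \<Rightarrow> protocol \<Rightarrow> run set" where
  "runs Ag k F P = {r. (\<exists>\<alpha>\<in>F. r 0 = initial \<alpha>) \<and> (\<forall>m. r (Suc m) = step Ag k P (r m))}"


subsection \<open>Knowledge and knowledge-based programs\<close>

type_synonym fact = "run \<Rightarrow> nat \<Rightarrow> bool"

definition knows :: "nat \<Rightarrow> run set \<Rightarrow> agent \<Rightarrow> fact \<Rightarrow> fact" where
  "knows k R i \<phi> r m \<longleftrightarrow>
     (\<forall>r'\<in>R. \<forall>m'. local_of k (r' m') i = local_of k (r m) i \<longrightarrow> \<phi> r' m')"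

definition going :: "nat \<Rightarrow> agent \<Rightarrow> fact" where
  "going k i r m \<longleftrightarrow> front (local_of k (r m) i) \<and> \<not> front (local_of k (r (Suc m)) i)"

text \<open>
  \<open>P\<close> implements the program \<open>if K\<^sub>i (\<phi> i) then Go else Noop\<close> in the context with adversaries \<open>F\<close>.
\<close>

definition implements ::
  "nat set \<Rightarrow> nat \<Rightarrow> adversary set \<Rightarrow> protocol \<Rightarrow> (agent \<Rightarrow> fact) \<Rightarrow> bool" where
  "implements Ag k F P \<phi> \<longleftrightarrow>
     (\<forall>r\<in>runs Ag k F P. \<forall>m. \<forall>i\<in>Ag.
        P i (local_of k (r m) i) = Go \<longleftrightarrow> knows k (runs Ag k F P) i (\<phi> i) r m)"

text \<open>For \<open>a, b < k\<close>, the cyclic interval \<open>[a, b)\<close> modulo \<open>k\<close>, listed in cyclic order from \<open>a\<close>.\<close>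

definition cyclic :: "nat \<Rightarrow> nat \<Rightarrow> nat \<Rightarrow> nat list" where
  "cyclic k a b = map (\<lambda>d. (a + d) mod k) [0..<(b + k - a) mod k]"

text \<open>An adversary history at time \<open>m\<close> has length \<open>m\<close>, so \<open>next\<close> depends on the time only.\<close>

definition next_lane :: "nat \<Rightarrow> nat \<Rightarrow> nat" where
  "next_lane k m = m mod k"

definition prog_V :: "nat set \<Rightarrow> nat \<Rightarrow> (move \<times> move) set \<Rightarrow> agent \<Rightarrow> fact" where
  "prog_V Ag k Comp i r m \<longleftrightarrow>
     (\<forall>l. lane (local_of k (r m) i) = In l \<longrightarrow>
        compatible Comp (l, intent (local_of k (r m) i))
          {(lj, intent (local_of k (r m) j)) | j lj.
             j \<in> Ag \<and> j \<noteq> i \<and> lane (local_of k (r m) j) = In lj \<and>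
             lj \<in> set (cyclic k (next_lane k m) l) \<and> going k j r m})"

text \<open>The formula whose knowledge is tested by the program.\<close>

definition prog_test :: "nat set \<Rightarrow> nat \<Rightarrow> (move \<times> move) set \<Rightarrow> agent \<Rightarrow> fact" where
  "prog_test Ag k Comp i r m \<longleftrightarrow> front (local_of k (r m) i) \<and> prog_V Ag k Comp i r m"


subsection \<open>The protocol\<close>

text \<open>
  Only front agents broadcast, so a memory \<open>M\<close> contains at most one move from each lane \<open>l\<close>.
\<close>

definition pos_step ::
  "nat \<Rightarrow> nat \<Rightarrow> (move \<times> move) set \<Rightarrow> move set \<Rightarrow> nat \<Rightarrow> move set \<Rightarrow> move set" where
  "pos_step k n Comp M l Pos =
     (if \<exists>l'\<in>out_lanes k n. (l, l') \<in> M
      then Pos \<union> {(l, l') | l'. l' \<in> out_lanes k n \<and> (l, l') \<in> M \<and> compatible Comp (l, l') Pos}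
      else Pos \<union> {(l, l') | l'. l' \<in> out_lanes k n \<and> compatible Comp (l, l') Pos})"

definition pos_moves ::
  "nat \<Rightarrow> nat \<Rightarrow> (move \<times> move) set \<Rightarrow> move set \<Rightarrow> nat \<Rightarrow> nat \<Rightarrow> move set" where
  "pos_moves k n Comp M a b = fold (pos_step k n Comp M) (cyclic k a b) {}"

definition P_intent :: "nat \<Rightarrow> nat \<Rightarrow> (move \<times> move) set \<Rightarrow> protocol" where
  "P_intent k n Comp i s =
     (case lane s of
        In l \<Rightarrow>
          (if front s \<and>
              compatible Comp (l, intent s)
                (pos_moves k n Comp (memory s) (next_lane k (clock s)) l)
           then Go else Noop)
      | _ \<Rightarrow> Noop)"

end

theory Submission
  imports Defs
begin

text \<open>
  Since receivers never fail and front positions always hear each other, all front agents share the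
  same memory. Hence every front agent can recompute the sets \<open>Pos\<close> of the front agents that
  precede it in the cyclic order, and \<open>Pos\<^sub>i\<close> contains the moves of all of them that go; this gives
  soundness. Conversely, let \<open>(l, l')\<close> be a move in \<open>Pos\<^sub>i\<close> that conflicts with the move of \<open>i\<close>.
  If it was received, its sender goes. Otherwise lane \<open>l\<close> was silent, and \<open>i\<close> cannot exclude the
  run in which exactly the present front agents, together with an agent in lane \<open>l\<close> with intent
  \<open>l'\<close> and broken transmitter, have just arrived; there that agent goes.
\<close>

section \<open>The computation of possible moves\<close>

text \<open>The offset \<open>d\<close> is below \<open>k\<close>, so \<open>a + d\<close> wraps
  around at most once and subtracting \<open>a\<close> modulo \<open>k\<close> recovers
  \<open>d\<close>.\<close>

lemma take_cyclic:
  assumes "a < k" and "d < (b + k - a) mod k"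
  shows "cyclic k a ((a + d) mod k) = take d (cyclic k a b)"
proof -
  have "(b + k - a) mod k < k" using assms(1) by simp
  then have "d < k" using assms(2) by (rule less_trans[rotated])
  have "((a + d) mod k + k - a) mod k = d"
  proof (cases "a + d < k")
    case True
    then show ?thesis using \<open>d < k\<close> by simp
  next
    case False
    then have "(a + d) mod k = a + d - k"
      using \<open>a < k\<close> \<open>d < k\<close> by (simp add: le_mod_geq)
    then show ?thesis using False \<open>d < k\<close> by simp
  qed
  then show ?thesis using assms by (simp add: cyclic_def take_map)
qed

text \<open>A lane determines its offset from \<open>a\<close>, so what precedes it in the list is
  again a cyclic interval. Hence the computation of \<open>pos_moves\<close> for a later lane passes
  through the result for each earlier lane.\<close>

lemma cyclic_split:
  assumes "a < k" and "cyclic k a b = xs @ l # ys"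
  shows "xs = cyclic k a l"
proof -
  let ?d = "length xs"
  have "?d < length (cyclic k a b)" using assms(2) by simp
  then have d: "?d < (b + k - a) mod k" by (simp add: cyclic_def)
  have "l = cyclic k a b ! ?d" using assms(2) by simp
  then have "l = (a + ?d) mod k" using d by (simp add: cyclic_def)
  then show ?thesis using take_cyclic[OF assms(1) d] assms(2) by simp
qed

text \<open>If \<open>l\<close> were \<open>b\<close>, the proper prefix before it would be as long
  as the whole list.\<close>

lemma in_set_cyclic:
  assumes "a < k" and "b < k" and "l \<in> set (cyclic k a b)"
  shows "l < k" and "l \<noteq> b"
proof -
  obtain xs ys where s: "cyclic k a b = xs @ l # ys" using assms(3) by (meson split_list)
  show "l < k" using assms by (auto simp: cyclic_def)
  have "xs = cyclic k a l" using cyclic_split[OF assms(1) s] .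
  then have "length (cyclic k a b) \<noteq> length (cyclic k a l)" using s by simp
  then show "l \<noteq> b" by metis
qed

text \<open>A step adds only moves of its own lane, tests them against the set accumulated so far,
  and removes nothing. Membership is thus decided at an occurrence of \<open>l\<close> by the fold
  over the preceding lanes. The final implication merges the heard and the silent branch of
  \<open>pos_step\<close>.\<close>

lemma mem_fold_pos_step:
  "(l, l') \<in> fold (pos_step k n Comp M) ls {} \<longleftrightarrow>
     (\<exists>xs ys. ls = xs @ l # ys \<and> l' \<in> out_lanes k n \<and>
        compatible Comp (l, l') (fold (pos_step k n Comp M) xs {}) \<and>
        ((\<exists>l''\<in>out_lanes k n. (l, l'') \<in> M) \<longrightarrow> (l, l') \<in> M))"
  (is "_ \<longleftrightarrow> (\<exists>xs ys. ls = xs @ l # ys \<and> ?C xs)")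
proof (induction ls rule: rev_induct)
  case Nil
  then show ?case by simp
next
  case (snoc x ls)
  have "(l, l') \<in> fold (pos_step k n Comp M) (ls @ [x]) {} \<longleftrightarrow>
      (l, l') \<in> fold (pos_step k n Comp M) ls {} \<or> l = x \<and> ?C ls"
    by (auto simp: pos_step_def)
  also have "\<dots> \<longleftrightarrow> (\<exists>xs ys. ls = xs @ l # ys \<and> ?C xs) \<or> l = x \<and> ?C ls"
    using snoc.IH by simp
  also have "\<dots> \<longleftrightarrow> (\<exists>xs ys. ls @ [x] = xs @ l # ys \<and> ?C xs)"
  proof -
    \<comment> \<open>The chosen occurrence of \<open>l\<close> lies either inside \<open>ls\<close>
      or at the new last position.\<close>
    have *: "ls @ [x] = xs @ l # ys \<longleftrightarrow>
        (\<exists>zs. ys = zs @ [x] \<and> ls = xs @ l # zs) \<or> ys = [] \<and> l = x \<and> xs = ls" for xs ys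
      by (cases ys rule: rev_cases) auto
    show ?thesis unfolding * by iprover
  qed
  finally show ?case .
qed

text \<open>The prefix before \<open>l\<close> is the interval from \<open>a\<close> to
  \<open>l\<close>, so the fold disappears. The compatibility clause is now the very test that a
  front agent of lane \<open>l\<close> with memory \<open>M\<close> and intent \<open>l'\<close>
  performs.\<close>

lemma mem_pos_moves:
  assumes "a < k"
  shows "(l, l') \<in> pos_moves k n Comp M a b \<longleftrightarrow>
     l \<in> set (cyclic k a b) \<and> l' \<in> out_lanes k n \<and>
     compatible Comp (l, l') (pos_moves k n Comp M a l) \<and>
     ((\<exists>l''\<in>out_lanes k n. (l, l'') \<in> M) \<longrightarrow> (l, l') \<in> M)"
proof -
  have "(\<exists>xs ys. cyclic k a b = xs @ l # ys \<and> Q xs) \<longleftrightarrow> l \<in> set (cyclic k a b) \<and> Q (cyclic k a l)"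
    for Q
    using cyclic_split[OF assms, of b _ l] by (auto simp: in_set_conv_decomp)
  then show ?thesis
    unfolding pos_moves_def mem_fold_pos_step[of l l' k n Comp M "cyclic k a b"] by simp
qed


section \<open>Reachable states\<close>

text \<open>An invariant of runs: the arrival lane keeps different queues disjoint, and the bound on
  arrival times makes every new arrival a fresh agent.\<close>

definition wf_env :: "nat set \<Rightarrow> env_state \<Rightarrow> bool" where
  "wf_env Ag e \<longleftrightarrow>
     (\<forall>l. distinct (queue e l) \<and>
       (\<forall>i\<in>set (queue e l). i \<in> Ag \<and> arr_lane (adv e) i = l \<and> arr_time (adv e) i \<le> time e))"

lemma located_wf:
  assumes "wf_env Ag e" and "located k e i x"
  shows "i \<in> Ag" and "fst x = arr_lane (adv e) i" and "arr_time (adv e) i \<le> time e"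
    and "fst x < k"
proof -
  have "i \<in> set (queue e (fst x))" and "fst x < k"
    using assms(2) by (auto simp: located_def in_lanes_def)
  then show "i \<in> Ag" and "fst x = arr_lane (adv e) i" and "arr_time (adv e) i \<le> time e"
    and "fst x < k"
    using assms(1) by (auto simp: wf_env_def)
qed

lemma located_unique:
  assumes "wf_env Ag e" and "located k e i x" and "located k e i y"
  shows "x = y"
proof -
  have "fst x = fst y" using located_wf(2)[OF assms(1)] assms(2,3) by metis
  moreover have "snd x = snd y"
    using assms \<open>fst x = fst y\<close> unfolding wf_env_def located_def
    by (metis nth_eq_iff_index_eq)
  ultimately show ?thesis by (rule prod_eqI)
qed

lemma located_same_position:
  "located k e i x \<Longrightarrow> located k e j x \<Longrightarrow> i = j"
  by (simp add: located_def)

lemma location_of_eq: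
  assumes "wf_env Ag e" and "located k e i x"
  shows "location_of k e i = x"
  unfolding location_of_def using assms located_unique by blast

lemma lane_of_eq:
  assumes "wf_env Ag e" and "located k e i x"
  shows "lane_of k e i = In (fst x)"
proof -
  have "queued k e i" unfolding queued_def using assms(2) by blast
  then show ?thesis using location_of_eq[OF assms] by (simp add: lane_of_def)
qed

lemma broadcast_eq:
  assumes "wf_env Ag e" and "located k e j (l, 0)"
  shows "broadcast k e j = Some (l, dep_lane (adv e) j)"
  using assms location_of_eq[OF assms] by (auto simp: broadcast_def at_front_def)

lemma SO_arrivals:
  assumes "\<alpha> \<in> SO Ag k n" and "i \<in> Ag"
  shows "{j \<in> Ag. arr_time \<alpha> j = arr_time \<alpha> i \<and> arr_lane \<alpha> j = arr_lane \<alpha> i} = {i}"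
  using assms unfolding SO_def adversaries_def by blast

lemma SO_arriving:
  assumes "\<alpha> \<in> SO Ag k n" and "i \<in> Ag"
  shows "arriving Ag \<alpha> (arr_time \<alpha> i) (arr_lane \<alpha> i) = [i]"
  by (simp add: arriving_def SO_arrivals[OF assms])

text \<open>\<open>sorted_list_of_set\<close> is meaningful only on finite sets, and
  \<open>Ag\<close> may be infinite. Here the set is empty or a singleton, since simultaneous
  arrivals use different lanes.\<close>

lemma set_arriving:
  assumes "\<alpha> \<in> SO Ag k n"
  shows "set (arriving Ag \<alpha> m l) = {i \<in> Ag. arr_time \<alpha> i = m \<and> arr_lane \<alpha> i = l}"
proof (cases "{i \<in> Ag. arr_time \<alpha> i = m \<and> arr_lane \<alpha> i = l} = {}")
  case True
  then show ?thesis unfolding arriving_def True by simp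
next
  case False
  then obtain i where i: "i \<in> Ag" "m = arr_time \<alpha> i" "l = arr_lane \<alpha> i" by blast
  show ?thesis
    unfolding i(2,3) SO_arriving[OF assms i(1)] SO_arrivals[OF assms i(1)] by simp
qed

lemma run_Suc: "r \<in> runs Ag k F P \<Longrightarrow> r (Suc m) = step Ag k P (r m)"
  by (simp add: runs_def)

lemma run_adv:
  assumes r: "r \<in> runs Ag k F P"
  shows "adv (env (r m)) = adv (env (r 0))"
  by (induction m) (simp_all add: run_Suc[OF r] step_def Let_def env_step_def)

lemma run_adv_in:
  assumes r: "r \<in> runs Ag k F P"
  shows "adv (env (r m)) \<in> F"
  using r unfolding run_adv[OF r, of m] by (auto simp: runs_def initial_def)

lemma run_time:
  assumes r: "r \<in> runs Ag k F P"
  shows "time (env (r m)) = m"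
proof (induction m)
  case 0
  then show ?case using r by (auto simp: runs_def initial_def)
next
  case (Suc m)
  then show ?case by (simp add: run_Suc[OF r] step_def Let_def env_step_def)
qed

lemma run_queue_Suc:
  assumes "r \<in> runs Ag k F P"
  shows "queue (env (r (Suc m))) l =
     (case queue (env (r m)) l of [] \<Rightarrow> []
      | i # q \<Rightarrow> if P i (local_of k (r m) i) = Go then q else i # q)
     @ arriving Ag (adv (env (r m))) (Suc m) l"
  using run_time[OF assms] by (simp add: run_Suc[OF assms] step_def Let_def env_step_def)

lemma run_wf:
  assumes r: "r \<in> runs Ag k (SO Ag k n) P"
  shows "wf_env Ag (env (r m))"
proof (induction m)
  case 0
  then show ?case using r by (auto simp: runs_def initial_def wf_env_def)
next
  case (Suc m)
  have \<alpha>: "adv (env (r (Suc m))) = adv (env (r m))" by (metis r run_adv)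
  show ?case
    unfolding wf_env_def
  proof (intro allI conjI ballI)
    fix l
    let ?A = "arriving Ag (adv (env (r m))) (Suc m) l"
    let ?Q = "case queue (env (r m)) l of [] \<Rightarrow> []
      | i # q \<Rightarrow> if P i (local_of k (r m) i) = Go then q else i # q"
    have A: "set ?A = {i \<in> Ag. arr_time (adv (env (r m))) i = Suc m \<and> arr_lane (adv (env (r m))) i = l}"
      by (rule set_arriving[OF run_adv_in[OF r]])
    have Q: "set ?Q \<subseteq> set (queue (env (r m)) l)" "distinct ?Q"
    proof -
      have "distinct (queue (env (r m)) l)" using Suc.IH by (simp add: wf_env_def)
      then show "set ?Q \<subseteq> set (queue (env (r m)) l)" "distinct ?Q"
        by (cases "queue (env (r m)) l"; auto)+
    qed
    have old: "i \<in> Ag \<and> arr_lane (adv (env (r m))) i = l \<and> arr_time (adv (env (r m))) i \<le> m"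
      if "i \<in> set ?Q" for i
    proof -
      have "i \<in> set (queue (env (r m)) l)" using Q(1) that by (rule subsetD)
      then show ?thesis using Suc.IH run_time[OF r] by (simp add: wf_env_def)
    qed
    \<comment> \<open>Agents already queued arrived by time \<open>m\<close>, the new ones at
      \<open>Suc m\<close>.\<close>
    have "set ?Q \<inter> set ?A = {}" using old A by fastforce
    moreover have "distinct ?A" by (simp add: arriving_def)
    ultimately show "distinct (queue (env (r (Suc m))) l)"
      using Q(2) by (simp add: run_queue_Suc[OF r])
    fix i
    assume "i \<in> set (queue (env (r (Suc m))) l)"
    then have "i \<in> set ?Q \<or> i \<in> set ?A" by (simp only: run_queue_Suc[OF r] set_append Un_iff)
    then show "i \<in> Ag" and "arr_lane (adv (env (r (Suc m)))) i = l"
      and "arr_time (adv (env (r (Suc m)))) i \<le> time (env (r (Suc m)))"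
      unfolding \<alpha> run_time[OF r] using old A by fastforce+
  qed
qed

section \<open>Front agents: leaving the front, and their common memory\<close>

lemma located_front_iff:
  "located k e i (l, 0) \<longleftrightarrow> l < k \<and> (\<exists>q. queue e l = i # q)"
  by (cases "queue e l") (auto simp: located_def in_lanes_def)

text \<open>An agent that leaves the front cannot reappear there: its lane is fixed, it does not
  occur in the tail of its queue, and its arrival time has passed.\<close>

lemma going_iff_Go:
  assumes r: "r \<in> runs Ag k (SO Ag k n) P" and j: "located k (env (r m)) j (l, 0)"
  shows "going k j r m \<longleftrightarrow> P j (local_of k (r m) j) = Go"
proof -
  let ?e = "env (r m)" and ?e' = "env (r (Suc m))"
  obtain q where l: "l < k" and q: "queue ?e l = j # q" using j by (auto simp: located_front_iff)
  have e: "wf_env Ag ?e" and e': "wf_env Ag ?e'" by (fact run_wf[OF r])+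
  have \<alpha>: "adv ?e' = adv ?e" by (metis r run_adv)
  have "at_front k ?e j" using j by (auto simp: at_front_def)
  moreover have "at_front k ?e' j \<longleftrightarrow> P j (local_of k (r m) j) \<noteq> Go"
  proof
    assume "P j (local_of k (r m) j) \<noteq> Go"
    then show "at_front k ?e' j"
      using l q by (auto simp: at_front_def located_front_iff run_queue_Suc[OF r])
  next
    assume "at_front k ?e' j"
    then obtain x where x: "located k ?e' j (x, 0)" by (auto simp: at_front_def)
    have "x = l" using located_wf(2)[OF e' x] located_wf(2)[OF e j] \<alpha> by simp
    then have in': "j \<in> set (queue ?e' l)" using x by (auto simp: located_front_iff)
    show "P j (local_of k (r m) j) \<noteq> Go"
    proof
      assume "P j (local_of k (r m) j) = Go"
      then have "j \<in> set q \<union> set (arriving Ag (adv ?e) (Suc m) l)"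
        using in' q by (simp add: run_queue_Suc[OF r])
      moreover have "j \<notin> set q" using e q unfolding wf_env_def by (metis distinct.simps(2))
      moreover have "arr_time (adv ?e) j \<le> m" using located_wf(3)[OF e j] run_time[OF r] by simp
      ultimately show False using set_arriving[OF run_adv_in[OF r]] by auto
    qed
  qed
  ultimately show ?thesis by (auto simp: going_def local_of_def)
qed

text \<open>The common memory of all front agents, described without reference to a receiver.
  Messages in memory at time \<open>m\<close> were sent in round \<open>m\<close>, whose failures
  have index \<open>m - 1\<close>; at time 0 the queues of a run are empty, so truncated subtraction
  does no harm.\<close>

definition heard :: "nat \<Rightarrow> run \<Rightarrow> nat \<Rightarrow> move set" where
  "heard k r m = {(l, dep_lane (adv (env (r m))) j) | l j.
     located k (env (r m)) j (l, 0) \<and> xmit_ok (adv (env (r m))) (m - 1) j}"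

lemma located_time_pos:
  assumes r: "r \<in> runs Ag k F P" and i: "located k (env (r m)) i x"
  shows "0 < m"
proof (rule ccontr)
  assume "\<not> 0 < m"
  then show False using r i by (auto simp: runs_def initial_def located_def)
qed

text \<open>Only front agents broadcast, receivers never fail, and every transmission environment
  links all pairs of front positions. What a front agent receives therefore depends on the
  transmitters alone.\<close>

lemma mem_front_eq_heard:
  assumes r: "r \<in> runs Ag k (SO Ag k n) P" and i: "located k (env (r m)) i (l, 0)"
  shows "mem (r m) i = heard k r m"
proof -
  let ?e = "env (r m)"
  have e: "wf_env Ag ?e" by (rule run_wf[OF r])
  have \<alpha>: "adv ?e \<in> SO Ag k n" by (rule run_adv_in[OF r])
  obtain m0 where m: "m = Suc m0" using located_time_pos[OF r i] by (cases m) auto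
  have "mem (r m) i = received Ag k m0 ?e i"
    using run_time[OF r] by (simp add: m run_Suc[OF r] step_def Let_def)
  also have "\<dots> = {\<mu>. \<exists>j\<in>Ag. broadcast k ?e j = Some \<mu> \<and> xmit_ok (adv ?e) m0 j \<and>
                 (location_of k ?e j, (l, 0)) \<in> env_trans (adv ?e)}"
    using i \<alpha> located_wf(1)[OF e i] location_of_eq[OF e i]
    by (auto simp: received_def queued_def SO_def)
  also have "\<dots> = heard k r m"
  proof -
    have "(\<exists>j\<in>Ag. broadcast k ?e j = Some \<mu> \<and> xmit_ok (adv ?e) m0 j \<and>
                 (location_of k ?e j, (l, 0)) \<in> env_trans (adv ?e)) \<longleftrightarrow>
          (\<exists>x j. \<mu> = (x, dep_lane (adv ?e) j) \<and> located k ?e j (x, 0) \<and> xmit_ok (adv ?e) m0 j)"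
      (is "?L \<longleftrightarrow> ?R") for \<mu>
    proof
      assume ?L
      then obtain j where j: "broadcast k ?e j = Some \<mu>" "xmit_ok (adv ?e) m0 j" by blast
      then obtain x where x: "located k ?e j (x, 0)"
        by (auto simp: broadcast_def at_front_def split: if_splits)
      then show ?R using j broadcast_eq[OF e x] by auto
    next
      assume ?R
      then obtain x j where x: "\<mu> = (x, dep_lane (adv ?e) j)" "located k ?e j (x, 0)"
        "xmit_ok (adv ?e) m0 j" by blast
      have "((x, 0), (l, 0)) \<in> env_trans (adv ?e)"
        using \<alpha> x(2) i
        by (auto simp: SO_def adversaries_def transmission_env_def located_def)
      then show ?L
        using x broadcast_eq[OF e x(2)] location_of_eq[OF e x(2)] located_wf(1)[OF e x(2)] by auto
    qed
    then show ?thesis by (auto simp: heard_def m)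
  qed
  finally show ?thesis .
qed

text \<open>With the memory replaced by \<open>heard\<close>, the decision of one front agent is
  expressed through data shared by all of them, apart from its own move.\<close>

lemma P_intent_front:
  assumes r: "r \<in> runs Ag k (SO Ag k n) P" and i: "located k (env (r m)) i (l, 0)"
  shows "P_intent k n Comp i (local_of k (r m) i) = Go \<longleftrightarrow>
    compatible Comp (l, dep_lane (adv (env (r m))) i)
      (pos_moves k n Comp (heard k r m) (m mod k) l)"
proof -
  have "local_of k (r m) i = \<lparr>memory = heard k r m, front = True, lane = In l,
      intent = dep_lane (adv (env (r m))) i, clock = m\<rparr>"
    using i lane_of_eq[OF run_wf[OF r] i] mem_front_eq_heard[OF r i] run_time[OF r, of m]
    by (auto simp: local_of_def at_front_def)
  then show ?thesis by (simp add: P_intent_def next_lane_def)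
qed

section \<open>Soundness: an agent that goes satisfies the test\<close>

lemma SO_lanes:
  assumes "\<alpha> \<in> SO Ag k n" and "i \<in> Ag"
  shows "arr_lane \<alpha> i < k" and "dep_lane \<alpha> i \<in> out_lanes k n"
  using assms by (auto simp: SO_def adversaries_def in_lanes_def)

text \<open>A lane has only one front agent, so at most one move is heard from it.\<close>

lemma heard_front:
  assumes "located k (env (r m)) j (l, 0)" and "(l, l') \<in> heard k r m"
  shows "l' = dep_lane (adv (env (r m))) j" and "xmit_ok (adv (env (r m))) (m - 1) j"
proof -
  obtain a where "l' = dep_lane (adv (env (r m))) a" "located k (env (r m)) a (l, 0)"
    "xmit_ok (adv (env (r m))) (m - 1) a"
    using assms(2) by (auto simp: heard_def)
  moreover from this(2) assms(1) have "a = j" by (rule located_same_position)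
  ultimately show "l' = dep_lane (adv (env (r m))) j" and "xmit_ok (adv (env (r m))) (m - 1) j"
    by simp_all
qed

text \<open>The test passed by \<open>j\<close> is the compatibility clause of
  \<open>mem_pos_moves\<close>. If its lane was heard at all, the move heard is that of
  \<open>j\<close>.\<close>

lemma going_move_possible:
  assumes r: "r \<in> runs Ag k (SO Ag k n) (P_intent k n Comp)" and "0 < k"
    and j: "located k (env (r m)) j (x, 0)" and x: "x \<in> set (cyclic k (m mod k) l)"
    and "going k j r m"
  shows "(x, dep_lane (adv (env (r m))) j) \<in> pos_moves k n Comp (heard k r m) (m mod k) l"
proof -
  have "compatible Comp (x, dep_lane (adv (env (r m))) j)
      (pos_moves k n Comp (heard k r m) (m mod k) x)"
    using assms going_iff_Go[OF r j] P_intent_front[OF r j] by simp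
  moreover have "dep_lane (adv (env (r m))) j \<in> out_lanes k n"
    using SO_lanes(2)[OF run_adv_in[OF r]] located_wf(1)[OF run_wf[OF r] j] by simp
  moreover have "m mod k < k" using \<open>0 < k\<close> by simp
  ultimately show ?thesis
    using x heard_front(1)[where r = r and m = m, OF j] by (auto simp: mem_pos_moves)
qed

text \<open>Every going agent in the relevant interval contributes a move of
  \<open>pos_moves\<close>, with which the move of \<open>i\<close> is compatible.\<close>

lemma Go_implies_prog_test:
  assumes r: "r \<in> runs Ag k (SO Ag k n) (P_intent k n Comp)" and "0 < k"
    and go: "P_intent k n Comp i (local_of k (r m) i) = Go"
  shows "prog_test Ag k Comp i r m"
proof -
  let ?e = "env (r m)"
  have e: "wf_env Ag ?e" by (rule run_wf[OF r])
  have "front (local_of k (r m) i)"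
    using go by (cases "lane (local_of k (r m) i)") (simp_all add: P_intent_def split: if_splits)
  then obtain l where i: "located k ?e i (l, 0)" by (auto simp: local_of_def at_front_def)
  have "\<nu> \<in> pos_moves k n Comp (heard k r m) (m mod k) l"
    if \<nu>: "\<nu> \<in> {(lj, intent (local_of k (r m) j)) | j lj.
             j \<in> Ag \<and> j \<noteq> i \<and> lane (local_of k (r m) j) = In lj \<and>
             lj \<in> set (cyclic k (next_lane k m) l) \<and> going k j r m}" for \<nu>
  proof -
    obtain j lj where j: "\<nu> = (lj, intent (local_of k (r m) j))"
      "lane (local_of k (r m) j) = In lj" "lj \<in> set (cyclic k (next_lane k m) l)" "going k j r m"
      using \<nu> by blast
    obtain x where x: "located k ?e j (x, 0)"
      using j(4) by (auto simp: going_def local_of_def at_front_def)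
    then have "x = lj" using j(2) lane_of_eq[OF e x] by (simp add: local_of_def)
    then show ?thesis
      using going_move_possible[OF r \<open>0 < k\<close> x] j by (simp add: local_of_def next_lane_def)
  qed
  moreover have "compatible Comp (l, dep_lane (adv ?e) i)
      (pos_moves k n Comp (heard k r m) (m mod k) l)"
    using go P_intent_front[OF r i] by simp
  ultimately have "compatible Comp (l, intent (local_of k (r m) i))
      {(lj, intent (local_of k (r m) j)) | j lj.
             j \<in> Ag \<and> j \<noteq> i \<and> lane (local_of k (r m) j) = In lj \<and>
             lj \<in> set (cyclic k (next_lane k m) l) \<and> going k j r m}"
    unfolding compatible_def by (simp only: local_of_def local_state.simps) blast
  moreover have "lane (local_of k (r m) i) = In l"
    using lane_of_eq[OF e i] by (simp add: local_of_def)
  ultimately show ?thesis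
    using \<open>front (local_of k (r m) i)\<close> by (simp add: prog_test_def prog_V_def)
qed


section \<open>The alternative run with a silent agent\<close>

primrec run_of :: "nat set \<Rightarrow> nat \<Rightarrow> protocol \<Rightarrow> adversary \<Rightarrow> run" where
  "run_of Ag k P \<alpha> 0 = initial \<alpha>"
| "run_of Ag k P \<alpha> (Suc m) = step Ag k P (run_of Ag k P \<alpha> m)"

lemma run_of_in_runs: "\<alpha> \<in> F \<Longrightarrow> run_of Ag k P \<alpha> \<in> runs Ag k F P"
  by (auto simp: runs_def)

lemma adv_run_of: "adv (env (run_of Ag k P \<alpha> m)) = \<alpha>"
  by (induction m) (auto simp: initial_def step_def Let_def env_step_def)

text \<open>Before time \<open>m\<close> all queues are empty whatever the protocol does, so each
  agent arriving at \<open>m\<close> goes straight to a front position.\<close>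

lemma front_run_of_first_arrival:
  assumes \<alpha>: "\<alpha> \<in> SO Ag k n" and late: "\<And>i. i \<in> Ag \<Longrightarrow> m \<le> arr_time \<alpha> i" and "0 < m"
  shows "located k (env (run_of Ag k P \<alpha> m)) i (l, 0) \<longleftrightarrow>
    i \<in> Ag \<and> arr_time \<alpha> i = m \<and> arr_lane \<alpha> i = l"
proof -
  let ?r = "run_of Ag k P \<alpha>"
  have r: "?r \<in> runs Ag k (SO Ag k n) P" using \<alpha> by (rule run_of_in_runs)
  have empty: "queue (env (?r t)) l = []" if "t < m" for t
    using that
  proof (induction t)
    case 0
    then show ?case by (simp add: initial_def)
  next
    case (Suc t)
    have "set (arriving Ag \<alpha> (Suc t) l) = {}"
      unfolding set_arriving[OF \<alpha>] using late Suc.prems by fastforce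
    then show ?case using Suc
      by (simp add: run_queue_Suc[OF r] adv_run_of del: run_of.simps)
  qed
  obtain m0 where m: "m = Suc m0" using \<open>0 < m\<close> by (cases m) auto
  have q: "queue (env (?r m)) l = arriving Ag \<alpha> m l"
    using empty[of m0] by (simp only: m run_queue_Suc[OF r] adv_run_of) simp
  show ?thesis
  proof
    assume "located k (env (?r m)) i (l, 0)"
    then have "i \<in> set (arriving Ag \<alpha> m l)" by (auto simp: located_front_iff q)
    then show "i \<in> Ag \<and> arr_time \<alpha> i = m \<and> arr_lane \<alpha> i = l" by (simp add: set_arriving[OF \<alpha>])
  next
    assume "i \<in> Ag \<and> arr_time \<alpha> i = m \<and> arr_lane \<alpha> i = l"
    then show "located k (env (?r m)) i (l, 0)"
      using SO_arriving[OF \<alpha>] SO_lanes(1)[OF \<alpha>] by (auto simp: located_front_iff q)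
  qed
qed

text \<open>
  Transmitters are constantly on or off, so that the adversary is in \<open>CR\<close>; the arrival times
  \<open>Suc m + a\<close> keep the remaining agents apart and out of the queues at time \<open>m\<close>.
\<close>

definition silent_adv :: "nat \<Rightarrow> env_state \<Rightarrow> nat \<Rightarrow> agent \<Rightarrow> move \<Rightarrow> adversary" where
  "silent_adv k e m j \<mu> =
     \<lparr> arrival = (\<lambda>a. if a = j then (m, \<mu>)
         else if at_front k e a then (m, arr_lane (adv e) a, dep_lane (adv e) a)
         else (Suc m + a, 0, k)),
       env_trans = (in_lanes k \<times> UNIV) \<times> (in_lanes k \<times> UNIV),
       xmit_ok = (\<lambda>_ a. a \<noteq> j \<and> xmit_ok (adv e) (m - 1) a),
       recv_ok = (\<lambda>_ _. True) \<rparr>"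

lemma CR_subset_SO: "CR Ag k n \<subseteq> SO Ag k n"
  by (auto simp: CR_def SO_def)

text \<open>Arrivals at time \<open>m\<close> do not collide: present front agents occupy different
  lanes, and by \<open>free\<close> none but \<open>j\<close> occupies lane \<open>l\<close>. The
  other agents arrive at pairwise different later times, with the legal lanes 0 and
  \<open>k\<close>.\<close>

lemma silent_adv_in_CR:
  assumes \<alpha>: "adv e \<in> SO Ag k n" and e: "wf_env Ag e" and "0 < k" and "k < n"
    and "l < k" and "l' \<in> out_lanes k n"
    and free: "\<And>a. located k e a (l, 0) \<Longrightarrow> a = j"
  shows "silent_adv k e m j (l, l') \<in> CR Ag k n"
proof -
  let ?\<beta> = "silent_adv k e m j (l, l')"
  have front: "located k e a (arr_lane (adv e) a, 0)" if "at_front k e a" for a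
    using that located_wf(2)[OF e] by (auto simp: at_front_def)
  have "arr_lane ?\<beta> a \<noteq> arr_lane ?\<beta> b" if "a \<noteq> b" and t: "arr_time ?\<beta> a = arr_time ?\<beta> b" for a b
  proof -
    have *: "arr_lane (adv e) a \<noteq> arr_lane (adv e) b" if "at_front k e a" "at_front k e b"
      using front[OF that(1)] front[OF that(2)] \<open>a \<noteq> b\<close> located_same_position by metis
    have **: "arr_lane (adv e) c \<noteq> l" if "at_front k e c" "c \<noteq> j" for c
      using front[OF that(1)] free that(2) by blast
    show ?thesis
      using t \<open>a \<noteq> b\<close> * **
      by (fastforce simp: silent_adv_def arr_time_def arr_lane_def split: if_splits)
  qed
  moreover have "arr_lane ?\<beta> a \<in> in_lanes k \<and> dep_lane ?\<beta> a \<in> out_lanes k n" if "a \<in> Ag" for a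
    using SO_lanes[OF \<alpha> that] assms
    by (auto simp: silent_adv_def arr_lane_def dep_lane_def in_lanes_def out_lanes_def)
  ultimately show ?thesis
    unfolding CR_def adversaries_def transmission_env_def
    by (auto simp: silent_adv_def)
qed

text \<open>An occupied lane supplies its own front agent. Otherwise the front agents come from at
  most \<open>k - 1\<close> lanes, and the bound on the number of agents leaves one that is not at a
  front.\<close>

lemma ex_silent_agent:
  assumes e: "wf_env Ag e" and "l < k" and fin: "finite Ag \<longrightarrow> k \<le> card Ag"
  obtains j where "j \<in> Ag" and "\<And>a. located k e a (l, 0) \<Longrightarrow> a = j"
    and "\<And>x. located k e j (x, 0) \<Longrightarrow> x = l"
proof (cases "\<exists>a. located k e a (l, 0)")
  case True
  then obtain j where j: "located k e j (l, 0)" by blast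
  then show ?thesis
    using that[of j] located_wf(1)[OF e j] located_same_position located_unique[OF e j] by blast
next
  case False
  let ?B = "{a. at_front k e a}"
  let ?h = "\<lambda>x. queue e x ! 0"
  have "?B \<subseteq> ?h ` ({..<k} - {l})"
    using False by (auto simp: at_front_def located_def in_lanes_def)
  then have "finite ?B" "card ?B \<le> card ({..<k} - {l})"
    by (auto intro: finite_subset surj_card_le)
  then have B: "finite ?B" "card ?B < k" using \<open>l < k\<close> by auto
  have "\<not> Ag \<subseteq> ?B"
  proof
    assume "Ag \<subseteq> ?B"
    then have "finite Ag" "card Ag \<le> card ?B" using B(1) by (auto intro: finite_subset card_mono)
    then show False using fin B(2) by simp
  qed
  then obtain j where "j \<in> Ag" "\<not> at_front k e j" by blast
  then show ?thesis using that[of j] False by (auto simp: at_front_def)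
qed

text \<open>The new run is built over \<open>CR\<close>, so that one construction serves both
  failure models. It agrees with the old one in everything that \<open>i\<close> observes: time,
  lane, intent and the moves heard.\<close>

lemma silent_run:
  assumes r: "r \<in> runs Ag k (SO Ag k n) P" and "0 < k" and "k < n"
    and i: "located k (env (r m)) i (li, 0)" and "l < k" and "l \<noteq> li"
    and l': "l' \<in> out_lanes k n"
    and silent: "\<And>x. (l, x) \<notin> heard k r m"
    and fin: "finite Ag \<longrightarrow> k \<le> card Ag"
  obtains r' j where "r' \<in> runs Ag k (CR Ag k n) P"
    and "local_of k (r' m) i = local_of k (r m) i" and "heard k r' m = heard k r m"
    and "located k (env (r' m)) j (l, 0)" and "dep_lane (adv (env (r' m))) j = l'"
    and "located k (env (r' m)) i (li, 0)"
proof -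
  let ?e = "env (r m)"
  have e: "wf_env Ag ?e" by (rule run_wf[OF r])
  obtain j where j: "j \<in> Ag" "\<And>a. located k ?e a (l, 0) \<Longrightarrow> a = j"
    "\<And>x. located k ?e j (x, 0) \<Longrightarrow> x = l"
    using ex_silent_agent[OF e \<open>l < k\<close> fin] by blast
  have "i \<noteq> j" using j(3) i \<open>l \<noteq> li\<close> by blast
  define \<beta> where "\<beta> = silent_adv k ?e m j (l, l')"
  have CR: "\<beta> \<in> CR Ag k n"
    unfolding \<beta>_def using silent_adv_in_CR[OF run_adv_in[OF r] e] assms j(2) by blast
  then have SO: "\<beta> \<in> SO Ag k n" using CR_subset_SO by blast
  define r' where "r' = run_of Ag k P \<beta>"
  have r'_CR: "r' \<in> runs Ag k (CR Ag k n) P"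
    unfolding r'_def using CR by (rule run_of_in_runs)
  have r': "r' \<in> runs Ag k (SO Ag k n) P"
    unfolding r'_def using SO by (rule run_of_in_runs)
  have adv': "adv (env (r' m)) = \<beta>" unfolding r'_def by (rule adv_run_of)
  have "0 < m" by (rule located_time_pos[OF r i])
  have late: "m \<le> arr_time \<beta> a" for a by (simp add: \<beta>_def silent_adv_def arr_time_def)
  have loc': "located k (env (r' m)) a (x, 0) \<longleftrightarrow> a \<in> Ag \<and> arr_time \<beta> a = m \<and> arr_lane \<beta> a = x" for a x
    unfolding r'_def using SO late \<open>0 < m\<close> by (rule front_run_of_first_arrival)
  have loc_j: "located k (env (r' m)) j (l, 0)"
    using j(1) unfolding loc' by (simp add: \<beta>_def silent_adv_def arr_time_def arr_lane_def)
  have loc_other: "located k (env (r' m)) a (x, 0) \<longleftrightarrow> located k ?e a (x, 0)" if "a \<noteq> j" for a x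
  proof -
    have "located k ?e a (x, 0) \<longleftrightarrow> a \<in> Ag \<and> at_front k ?e a \<and> arr_lane (adv ?e) a = x"
      using located_wf(1,2)[OF e] by (fastforce simp: at_front_def)
    then show ?thesis
      using that unfolding loc' by (auto simp: \<beta>_def silent_adv_def arr_time_def arr_lane_def)
  qed
  have dep_other: "dep_lane \<beta> a = dep_lane (adv ?e) a" if "a \<noteq> j" "located k ?e a (x, 0)" for a x
    using that by (auto simp: \<beta>_def silent_adv_def dep_lane_def at_front_def)
  have xmit: "xmit_ok \<beta> t a \<longleftrightarrow> a \<noteq> j \<and> xmit_ok (adv ?e) (m - 1) a" for t a
    by (simp add: \<beta>_def silent_adv_def)
  \<comment> \<open>If \<open>j\<close> was already a front agent, the silence of lane
    \<open>l\<close> shows that its transmitter failed. Muting \<open>j\<close> thus removes no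
    message.\<close>
  have mute: "\<not> xmit_ok (adv ?e) (m - 1) j" if "located k ?e j (x, 0)" for x
    using that j(3)[OF that] silent by (auto simp: heard_def)
  have heard: "heard k r' m = heard k r m"
  proof -
    have "\<mu> \<in> heard k r' m \<longleftrightarrow> \<mu> \<in> heard k r m" for \<mu>
    proof -
      have "\<mu> \<in> heard k r' m \<longleftrightarrow> (\<exists>a x. \<mu> = (x, dep_lane \<beta> a) \<and>
          located k (env (r' m)) a (x, 0) \<and> a \<noteq> j \<and> xmit_ok (adv ?e) (m - 1) a)"
        by (auto simp: heard_def adv' xmit)
      also have "\<dots> \<longleftrightarrow> (\<exists>a x. \<mu> = (x, dep_lane (adv ?e) a) \<and>
          located k ?e a (x, 0) \<and> a \<noteq> j \<and> xmit_ok (adv ?e) (m - 1) a)"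
        using loc_other dep_other by metis
      also have "\<dots> \<longleftrightarrow> \<mu> \<in> heard k r m"
        unfolding heard_def using mute by blast
      finally show ?thesis .
    qed
    then show ?thesis by blast
  qed
  have i': "located k (env (r' m)) i (li, 0)" using loc_other[OF \<open>i \<noteq> j\<close>] i by simp
  have "local_of k (r' m) i = local_of k (r m) i"
    using mem_front_eq_heard[OF r i] mem_front_eq_heard[OF r' i'] heard
      lane_of_eq[OF e i] lane_of_eq[OF run_wf[OF r'] i'] run_time[OF r] run_time[OF r']
      dep_other[OF \<open>i \<noteq> j\<close> i] i i' adv'
    by (auto simp: local_of_def at_front_def)
  moreover have "dep_lane (adv (env (r' m))) j = l'"
    by (simp add: adv' \<beta>_def silent_adv_def dep_lane_def)
  ultimately show ?thesis using that r'_CR heard loc_j i' by blast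
qed

section \<open>Completeness: knowledge of the test makes the agent go\<close>

lemma going_conflict_refutes_prog_test:
  assumes r: "r \<in> runs Ag k (SO Ag k n) (P_intent k n Comp)"
    and i: "located k (env (r m)) i (li, 0)" and j: "located k (env (r m)) j (l, 0)"
    and "l \<in> set (cyclic k (m mod k) li)" and "l \<noteq> li"
    and go: "compatible Comp (l, dep_lane (adv (env (r m))) j)
      (pos_moves k n Comp (heard k r m) (m mod k) l)"
    and "((li, dep_lane (adv (env (r m))) i), (l, dep_lane (adv (env (r m))) j)) \<notin> Comp"
  shows "\<not> prog_test Ag k Comp i r m"
proof -
  have e: "wf_env Ag (env (r m))" by (rule run_wf[OF r])
  have "j \<noteq> i" using located_unique[OF e i, of "(l, 0)"] j \<open>l \<noteq> li\<close> by blast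
  moreover have "going k j r m" using going_iff_Go[OF r j] P_intent_front[OF r j] go by blast
  moreover note lane_of_eq[OF e i] lane_of_eq[OF e j] located_wf(1)[OF e j]
  ultimately show ?thesis
    using assms by (fastforce simp: prog_test_def prog_V_def local_of_def next_lane_def compatible_def)
qed

text \<open>A conflicting move in the set computed by \<open>i\<close> is realized by a going agent,
  either at the present point or at one that \<open>i\<close> cannot distinguish from it. Bounding
  \<open>F\<close> between \<open>CR\<close> and \<open>SO\<close> treats both models at
  once.\<close>

lemma knows_implies_Go:
  assumes r: "r \<in> runs Ag k F (P_intent k n Comp)"
    and F: "CR Ag k n \<subseteq> F" "F \<subseteq> SO Ag k n" and "0 < k" and "k < n"
    and fin: "finite Ag \<longrightarrow> k \<le> card Ag"
    and knows: "knows k (runs Ag k F (P_intent k n Comp)) i (prog_test Ag k Comp i) r m"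
  shows "P_intent k n Comp i (local_of k (r m) i) = Go"
proof (rule ccontr)
  let ?P = "P_intent k n Comp" and ?M = "heard k r m" and ?d = "dep_lane (adv (env (r m)))"
  assume noop: "?P i (local_of k (r m) i) \<noteq> Go"
  have rSO: "r \<in> runs Ag k (SO Ag k n) ?P" using r F(2) by (auto simp: runs_def)
  have e: "wf_env Ag (env (r m))" by (rule run_wf[OF rSO])
  have test: "prog_test Ag k Comp i r' m'"
    if "r' \<in> runs Ag k F ?P" "local_of k (r' m') i = local_of k (r m) i" for r' m'
    using knows that unfolding knows_def by blast
  have "prog_test Ag k Comp i r m" using test r by blast
  then obtain li where i: "located k (env (r m)) i (li, 0)"
    by (auto simp: prog_test_def local_of_def at_front_def)
  have li: "li < k" using located_wf(4)[OF e i] by simp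
  have next_lt: "m mod k < k" using \<open>0 < k\<close> by simp
  obtain l l' where pos: "(l, l') \<in> pos_moves k n Comp ?M (m mod k) li"
    and conflict: "((li, ?d i), (l, l')) \<notin> Comp"
    using noop P_intent_front[OF rSO i] by (fastforce simp: compatible_def)
  then have l: "l \<in> set (cyclic k (m mod k) li)" and l': "l' \<in> out_lanes k n"
    and compat: "compatible Comp (l, l') (pos_moves k n Comp ?M (m mod k) l)"
    and M: "(\<exists>l''\<in>out_lanes k n. (l, l'') \<in> ?M) \<Longrightarrow> (l, l') \<in> ?M"
    using mem_pos_moves[OF next_lt] by auto
  have "l < k" "l \<noteq> li" using in_set_cyclic[OF next_lt li l] by auto
  show False
  proof (cases "(l, l') \<in> ?M")
    case True
    then obtain j where j: "located k (env (r m)) j (l, 0)" "l' = ?d j"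
      by (auto simp: heard_def)
    then show False
      using going_conflict_refutes_prog_test[OF rSO i j(1) l \<open>l \<noteq> li\<close>] compat conflict
        \<open>prog_test Ag k Comp i r m\<close> by simp
  next
    case False
    \<comment> \<open>By \<open>M\<close>, any move heard from lane \<open>l\<close> would force
      \<open>(l, l')\<close> to be heard as well.\<close>
    have silent: "(l, x) \<notin> ?M" for x
    proof
      assume x: "(l, x) \<in> ?M"
      then have "x \<in> out_lanes k n"
        using SO_lanes(2)[OF run_adv_in[OF rSO]] located_wf(1)[OF e]
        by (auto simp: heard_def)
      then show False using M x False by blast
    qed
    obtain r' j where r': "r' \<in> runs Ag k (CR Ag k n) ?P"
      and same: "local_of k (r' m) i = local_of k (r m) i" "heard k r' m = ?M"
      and j: "located k (env (r' m)) j (l, 0)" "dep_lane (adv (env (r' m))) j = l'"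
      and i': "located k (env (r' m)) i (li, 0)"
      using silent_run[OF rSO \<open>0 < k\<close> \<open>k < n\<close> i \<open>l < k\<close> \<open>l \<noteq> li\<close> l' silent fin] by blast
    have r'F: "r' \<in> runs Ag k F ?P" and r'SO: "r' \<in> runs Ag k (SO Ag k n) ?P"
      using r' F by (auto simp: runs_def)
    have "dep_lane (adv (env (r' m))) i = ?d i" using same(1) by (simp add: local_of_def)
    then have "\<not> prog_test Ag k Comp i r' m"
      using going_conflict_refutes_prog_test[OF r'SO i' j(1) l \<open>l \<noteq> li\<close>] compat conflict j(2) same(2)
      by simp
    then show False using test[OF r'F same(1)] by blast
  qed
qed

theorem proposition22:
  fixes Ag :: "nat set" and k n :: nat and Comp :: "(move \<times> move) set"
    and F :: "adversary set"
  assumes "1 < k" and "k < n"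
    and "Comp \<subseteq> moves k n \<times> moves k n" and "sym Comp"
    and "finite Ag \<longrightarrow> k \<le> card Ag"
    and "F \<in> {CR Ag k n, SO Ag k n}"
  shows "implements Ag k F (P_intent k n Comp) (prog_test Ag k Comp)"
proof -
  let ?R = "runs Ag k F (P_intent k n Comp)"
  have "0 < k" using assms(1) by simp
  have F: "CR Ag k n \<subseteq> F" "F \<subseteq> SO Ag k n" using assms(6) CR_subset_SO by auto
  have "P_intent k n Comp i (local_of k (r m) i) = Go \<longleftrightarrow> knows k ?R i (prog_test Ag k Comp i) r m"
    if r: "r \<in> ?R" for r m i
  proof
    assume go: "P_intent k n Comp i (local_of k (r m) i) = Go"
    show "knows k ?R i (prog_test Ag k Comp i) r m"
      unfolding knows_def
    proof (intro ballI allI impI)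
      fix r' m'
      assume "r' \<in> ?R" and same: "local_of k (r' m') i = local_of k (r m) i"
      then have "r' \<in> runs Ag k (SO Ag k n) (P_intent k n Comp)" using F(2) by (auto simp: runs_def)
      \<comment> \<open>The protocol reads only the local state, so \<open>i\<close> also goes at
        \<open>(r', m')\<close>, and soundness applies there.\<close>
      then show "prog_test Ag k Comp i r' m'"
        using Go_implies_prog_test \<open>0 < k\<close> go same by metis
    qed
  next
    assume "knows k ?R i (prog_test Ag k Comp i) r m"
    then show "P_intent k n Comp i (local_of k (r m) i) = Go"
      by (rule knows_implies_Go[OF r F \<open>0 < k\<close> assms(2,5)])
  qed
  then show ?thesis by (simp add: implements_def)
qed

end
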